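(* Let $A,B$ be real $m\times k$ matrices with $B_{ij}\ge 0$ for all $i,j$, let $S=x$ be a fixed (possibly mixed) strategy of player 1, i.e. a probability vector $x\in\mathbb{R}^m$, and set $\alpha_j:=(xA)_j$, $\beta_j:=(xB)_j$ for $j=1,\dots,k$. Let $v_*<v^*$ be real numbers. Suppose that $$\alpha_j+\beta_j v_*>v_*\quad\text{and}\quad \alpha_j+\beta_j v^*\ge v^*\qquad\text{for all } j=1,\dots,k .$$ Then for every initial value $V_0\in[v_*,v^*]$ repeated play of the strategy $S$ achieves a limiting value at least $v^*$: the sequence defined by $V_{n+1}=\min_{1\le j\le k}(\alpha_j+\beta_jV_n)$ has a limit $\underline V\in(-\infty,+\infty]$ and $\underline V\ge v^*$. Moreover the criterion is sharp: if for every $V_0\in[v_*,v^*]$ the sequence $V_n$ has a limit in $[-\infty,+\infty]$ that is at least $v^*$, then $\alpha_j+\beta_jv_*>v_*$ and $\alpha_j+\beta_jv^*\ge v^*$ for all $j$.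
   Context: A single-state generalized recursive game between player 1 (strategies $i=1,\dots,m$) and player 2 (strategies $j=1,\dots,k$) is given by a matrix $A$ of one-shot payoffs to player 1 and a matrix $B\ge0$ (entrywise) of stakes multipliers: in each round, with mixed strategies $x,y$, player 1 receives expected payoff $xAy^T$ and the stakes for continued play are multiplied by $xBy^T$ (not required to be $\le 1$). If the value of continuing the game is $V$, the round has payoff matrix $A+BV$. If player 1 always plays the fixed strategy $S=x$, the values forced in $n$ rounds, starting from initial (zero-round) value $V_0$, are given by $V_{n+1}=\min_j(\alpha_j+\beta_jV_n)$, where $\alpha_j=(xA)_j$, $\beta_j=(xB)_j$ are the payoffs and multipliers against pure responses $j$ of player 2. *)

theory Defs
  imports "HOL-Analysis.Analysis"
begin

definition mixed_strategy :: "real ^ 'm \<Rightarrow> bool" where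
  "mixed_strategy x \<longleftrightarrow> (\<forall>i. 0 \<le> x $ i) \<and> (\<Sum>i\<in>UNIV. x $ i) = 1"

text \<open>
  A matrix \<open>A :: real ^ 'k ^ 'm\<close> has its rows (strategies of player 1) indexed by \<open>'m\<close> and
  its columns (strategies of player 2) by \<open>'k\<close>, so \<open>x v* A\<close> is the row vector $xA$.
\<close>

definition pure_payoff :: "real ^ 'k ^ 'm \<Rightarrow> real ^ 'm \<Rightarrow> 'k \<Rightarrow> real" where
  "pure_payoff A x j = (x v* A) $ j"

definition pure_multiplier :: "real ^ 'k ^ 'm \<Rightarrow> real ^ 'm \<Rightarrow> 'k \<Rightarrow> real" where
  "pure_multiplier B x j = (x v* B) $ j"

primrec repeated_value ::
  "real ^ 'k ^ 'm \<Rightarrow> real ^ 'k ^ 'm \<Rightarrow> real ^ 'm \<Rightarrow> real \<Rightarrow> nat \<Rightarrow> real" where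
  "repeated_value A B x V0 0 = V0"
| "repeated_value A B x V0 (Suc n) =
     Min (range (\<lambda>j. pure_payoff A x j + pure_multiplier B x j * repeated_value A B x V0 n))"

end

theory Submission imports Defs begin

text \<open>
  One round of play acts on values by \<open>f v = (MIN j. \<alpha> j + \<beta> j * v)\<close>, which is monotone because
  \<open>\<beta> \<ge> 0\<close>. Each \<open>\<alpha> j + \<beta> j * v - v\<close> is affine in \<open>v\<close>, so the two endpoint conditions give
  \<open>f v > v\<close> on the half-open interval and \<open>f v \<ge> v\<close> at its upper end: orbits are increasing, and
  a limit below the upper end would be a fixed point of \<open>f\<close>. Conversely, a violated endpoint
  condition makes the orbit of that endpoint decreasing, with its limit below the upper end.
\<close>

lemma incseq_orbit:
  fixes V :: "nat \<Rightarrow> 'a::order"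
  assumes "\<And>n. V (Suc n) = f (V n)" "mono f" "V 0 \<le> f (V 0)"
  shows "incseq V"
proof (rule incseq_SucI)
  show "V n \<le> V (Suc n)" for n
    by (induction n) (use assms in \<open>auto dest: monoD\<close>)
qed

lemma decseq_orbit:
  fixes V :: "nat \<Rightarrow> 'a::order"
  assumes "\<And>n. V (Suc n) = f (V n)" "mono f" "f (V 0) \<le> V 0"
  shows "decseq V"
proof (rule decseq_SucI)
  show "V (Suc n) \<le> V n" for n
    by (induction n) (use assms in \<open>auto dest: monoD\<close>)
qed

text \<open>Since \<open>a + b * v - v\<close> is affine in \<open>v\<close>, its value at
  \<open>v\<close> times \<open>h - l\<close> is a weighted sum of its values at \<open>l\<close>
  and \<open>h\<close>, with weights \<open>h - v > 0\<close> and \<open>v - l \<ge> 0\<close>. The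
  positive weight falls on the strict endpoint.\<close>

lemma affine_gt_id:
  fixes a b :: real
  assumes "a + b * l > l" "a + b * h \<ge> h" "l \<le> v" "v < h"
  shows "a + b * v > v"
proof -
  have "(h - v) * (a + b * l - l) + (v - l) * (a + b * h - h) > 0"
    using assms by (intro add_pos_nonneg mult_pos_pos mult_nonneg_nonneg) auto
  also have "(h - v) * (a + b * l - l) + (v - l) * (a + b * h - h) = (h - l) * (a + b * v - v)"
    by (simp add: algebra_simps)
  finally show ?thesis
    using assms by (simp add: zero_less_mult_iff)
qed

text \<open>The map \<open>f\<close> of one round, detached from the matrices so that the orbit
  arguments see only the coefficients.\<close>

definition min_affine :: "('k::finite \<Rightarrow> real) \<Rightarrow> ('k \<Rightarrow> real) \<Rightarrow> real \<Rightarrow> real" where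
  "min_affine \<alpha> \<beta> v = Min (range (\<lambda>j. \<alpha> j + \<beta> j * v))"

lemma le_min_affine_iff: "c \<le> min_affine \<alpha> \<beta> v \<longleftrightarrow> (\<forall>j. c \<le> \<alpha> j + \<beta> j * v)"
  by (simp add: min_affine_def)

lemma less_min_affine_iff: "c < min_affine \<alpha> \<beta> v \<longleftrightarrow> (\<forall>j. c < \<alpha> j + \<beta> j * v)"
  by (simp add: min_affine_def)

lemma mono_min_affine:
  assumes "\<And>j. 0 \<le> \<beta> j"
  shows "mono (min_affine \<alpha> \<beta>)"
proof (rule monoI, unfold le_min_affine_iff, rule allI)
  fix v w :: real and j
  assume "v \<le> w"
  have "min_affine \<alpha> \<beta> v \<le> \<alpha> j + \<beta> j * v"
    using le_min_affine_iff by blast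
  also have "\<dots> \<le> \<alpha> j + \<beta> j * w"
    using assms \<open>v \<le> w\<close> by (simp add: mult_left_mono)
  finally show "min_affine \<alpha> \<beta> v \<le> \<alpha> j + \<beta> j * w" .
qed

lemma min_affine_orbit_limit_ge:
  fixes \<alpha> \<beta> :: "'k::finite \<Rightarrow> real" and V :: "nat \<Rightarrow> real"
  assumes V: "\<And>n. V (Suc n) = min_affine \<alpha> \<beta> (V n)" and \<beta>: "\<And>j. 0 \<le> \<beta> j"
    and lo: "\<And>j. \<alpha> j + \<beta> j * l > l" and hi: "\<And>j. \<alpha> j + \<beta> j * h \<ge> h"
    and V0: "V 0 \<in> {l..h}"
  shows "\<exists>L::ereal. (\<lambda>n. ereal (V n)) \<longlonglongrightarrow> L \<and> L \<noteq> -\<infinity> \<and> L \<ge> ereal h"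
proof -
  have gt: "v < min_affine \<alpha> \<beta> v" if "l \<le> v" "v < h" for v
    using affine_gt_id[OF lo hi] that by (simp add: less_min_affine_iff)
  have "V 0 \<le> min_affine \<alpha> \<beta> (V 0)"
  proof (cases "V 0 = h")
    case True
    then show ?thesis using hi by (simp add: le_min_affine_iff)
  next
    case False
    then show ?thesis using gt[of "V 0"] V0 by simp
  qed
  with V mono_min_affine[OF \<beta>] have inc: "incseq V"
    by (rule incseq_orbit)
  \<comment> \<open>The supremum is taken in \<open>ereal\<close> because the orbit may be
    unbounded, for instance when all multipliers exceed 1.\<close>
  define L where "L = (SUP n. ereal (V n))"
  have lim: "(\<lambda>n. ereal (V n)) \<longlonglongrightarrow> L"
    unfolding L_def using inc by (intro LIMSEQ_SUP) (auto simp: incseq_def)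
  have V_le: "ereal (V n) \<le> L" for n
    unfolding L_def by (rule SUP_upper) simp
  have "L \<ge> ereal h"
  proof (rule ccontr)
    assume "\<not> L \<ge> ereal h"
    \<comment> \<open>\<open>L\<close> lies below \<open>h\<close> and above \<open>V 0\<close>, so
      neither infinite value is possible.\<close>
    then obtain r where r: "L = ereal r" and "r < h"
      using V_le[of 0] by (cases L) auto
    have "l \<le> r"
      using V_le[of 0] V0 r by simp
    have "V \<longlonglongrightarrow> r"
      using lim by (simp add: r)
    \<comment> \<open>Limits are taken in each affine piece separately; as there are finitely many
      \<open>j\<close>, one \<open>n\<close> then serves all of them, and \<open>V (Suc n)\<close>
      exceeds the supremum \<open>r\<close>.\<close>
    then have "(\<lambda>n. \<alpha> j + \<beta> j * V n) \<longlonglongrightarrow> \<alpha> j + \<beta> j * r" for j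
      by (intro tendsto_intros)
    moreover have "r < \<alpha> j + \<beta> j * r" for j
      using gt[OF \<open>l \<le> r\<close> \<open>r < h\<close>] by (simp add: less_min_affine_iff)
    ultimately have "\<forall>\<^sub>F n in sequentially. r < \<alpha> j + \<beta> j * V n" for j
      using order_tendstoD(1) by blast
    then have "\<forall>\<^sub>F n in sequentially. \<forall>j. r < \<alpha> j + \<beta> j * V n"
      by (rule eventually_all_finite)
    then obtain n where "r < V (Suc n)"
      unfolding V less_min_affine_iff by (auto dest: eventually_happens)
    then show False
      using V_le[of "Suc n"] r by simp
  qed
  then show ?thesis
    using lim by (intro exI[of _ L]) auto
qed

text \<open>A decreasing sequence stays above its limit. The bound uses the first iterate instead of
  \<open>V 0\<close>, because for an orbit started at the upper end the bound by \<open>V 0\<close>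
  would yield no contradiction.\<close>

lemma decseq_orbit_limit_le:
  fixes V :: "nat \<Rightarrow> real"
  assumes "\<And>n. V (Suc n) = f (V n)" "mono f" "f (V 0) \<le> V 0"
    and lim: "(\<lambda>n. ereal (V n)) \<longlonglongrightarrow> L"
  shows "L \<le> ereal (f (V 0))"
proof -
  have "decseq V"
    using assms(1-3) by (rule decseq_orbit)
  then have "decseq (\<lambda>n. ereal (V n))"
    by (simp add: decseq_def)
  then have "L \<le> ereal (V (Suc 0))"
    using lim by (rule decseq_ge)
  then show ?thesis
    using assms(1) by simp
qed

lemma pure_multiplier_nonneg:
  assumes "\<And>i j. 0 \<le> B $ i $ j" "mixed_strategy x"
  shows "0 \<le> pure_multiplier B x j"
  using assms
  by (auto simp: pure_multiplier_def vector_matrix_mult_def mixed_strategy_def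
      intro!: sum_nonneg)

theorem theorem1p2:
  fixes A B :: "real ^ 'k ^ 'm"
    and x :: "real ^ 'm"
    and v_lo v_hi :: real
  assumes B_nonneg: "\<And>i j. 0 \<le> B $ i $ j"
    and strategy: "mixed_strategy x"
    and v_less: "v_lo < v_hi"
  shows
    "((\<forall>j. pure_payoff A x j + pure_multiplier B x j * v_lo > v_lo) \<and>
      (\<forall>j. pure_payoff A x j + pure_multiplier B x j * v_hi \<ge> v_hi)
      \<longrightarrow> (\<forall>V0\<in>{v_lo..v_hi}. \<exists>L::ereal.
            (\<lambda>n. ereal (repeated_value A B x V0 n)) \<longlonglongrightarrow> L \<and> L \<noteq> -\<infinity> \<and> L \<ge> ereal v_hi))
     \<and>
     ((\<forall>V0\<in>{v_lo..v_hi}. \<exists>L::ereal.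
            (\<lambda>n. ereal (repeated_value A B x V0 n)) \<longlonglongrightarrow> L \<and> L \<ge> ereal v_hi)
      \<longrightarrow> (\<forall>j. pure_payoff A x j + pure_multiplier B x j * v_lo > v_lo) \<and>
          (\<forall>j. pure_payoff A x j + pure_multiplier B x j * v_hi \<ge> v_hi))"
proof -
  let ?\<alpha> = "pure_payoff A x" and ?\<beta> = "pure_multiplier B x" and ?V = "repeated_value A B x"
  have V: "?V v (Suc n) = min_affine ?\<alpha> ?\<beta> (?V v n)" for v n
    by (simp add: min_affine_def)
  have \<beta>: "0 \<le> ?\<beta> j" for j
    using B_nonneg strategy by (rule pure_multiplier_nonneg)
  show ?thesis
  proof (rule conjI; rule impI)
    assume "(\<forall>j. ?\<alpha> j + ?\<beta> j * v_lo > v_lo) \<and> (\<forall>j. ?\<alpha> j + ?\<beta> j * v_hi \<ge> v_hi)"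
    then show "\<forall>V0\<in>{v_lo..v_hi}. \<exists>L::ereal. (\<lambda>n. ereal (?V V0 n)) \<longlonglongrightarrow> L \<and> L \<noteq> -\<infinity> \<and> L \<ge> ereal v_hi"
      by (intro ballI min_affine_orbit_limit_ge[where \<alpha> = ?\<alpha> and \<beta> = ?\<beta> and l = v_lo])
        \<comment> \<open>The defining recursion is removed so that \<open>V\<close> rewrites
          successors into \<open>min_affine\<close> form.\<close>
        (simp_all add: V \<beta> del: repeated_value.simps(2))
  next
    assume lim: "\<forall>V0\<in>{v_lo..v_hi}. \<exists>L::ereal. (\<lambda>n. ereal (?V V0 n)) \<longlonglongrightarrow> L \<and> L \<ge> ereal v_hi"
    have decreasing: "v_hi \<le> min_affine ?\<alpha> ?\<beta> v"
      if v: "v \<in> {v_lo..v_hi}" and dec: "min_affine ?\<alpha> ?\<beta> v \<le> v" for v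
    proof -
      obtain L where L: "(\<lambda>n. ereal (?V v n)) \<longlonglongrightarrow> L" "L \<ge> ereal v_hi"
        using lim v by blast
      have "L \<le> ereal (min_affine ?\<alpha> ?\<beta> (?V v 0))"
        using V mono_min_affine[OF \<beta>] _ L(1)
        by (rule decseq_orbit_limit_le[where f = "min_affine ?\<alpha> ?\<beta>"]) (simp add: dec)
      with L(2) have "ereal v_hi \<le> ereal (min_affine ?\<alpha> ?\<beta> (?V v 0))"
        by (rule order_trans)
      then show ?thesis
        by simp
    qed
    \<comment> \<open>Otherwise \<open>decreasing\<close> would put \<open>v_hi\<close> below
      \<open>min_affine ?\<alpha> ?\<beta> v_lo\<close>, hence below \<open>v_lo\<close>.\<close>
    have "v_lo < min_affine ?\<alpha> ?\<beta> v_lo"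
      using decreasing[of v_lo] v_less by (cases "v_lo < min_affine ?\<alpha> ?\<beta> v_lo") auto
    \<comment> \<open>Here the conclusion of \<open>decreasing\<close> is itself the negation of the
      failing case.\<close>
    moreover have "v_hi \<le> min_affine ?\<alpha> ?\<beta> v_hi"
      using decreasing[of v_hi] v_less by (cases "v_hi \<le> min_affine ?\<alpha> ?\<beta> v_hi") auto
    ultimately show "(\<forall>j. ?\<alpha> j + ?\<beta> j * v_lo > v_lo) \<and> (\<forall>j. ?\<alpha> j + ?\<beta> j * v_hi \<ge> v_hi)"
      by (simp add: less_min_affine_iff le_min_affine_iff)
  qed
qed

end
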